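(* Let $\beta,\gamma$ be non-negative integers with $(\beta,\gamma)\neq(0,0)$, and let $H_n(\beta,\gamma)$ denote the coefficient of $\frac{x^n}{n!}$ in $\frac{e^{\gamma x}}{2-e^{\beta x}}$. Then for every $n\ge0$, $$H_{n+1}(\beta,\gamma)=\gamma H_n(\beta,\gamma)+\beta\sum_{i=0}^{n}\binom{n}{i}H_i(\beta,\gamma)H_{n-i}(\beta,\beta).$$ *)

theory Defs
  imports "HOL-Computational_Algebra.Formal_Power_Series"
begin

text \<open>The denominator has constant term 1, so the quotient of formal power series is a
  genuine one for all parameters. The coefficient of \<open>x ^ n / n!\<close> is \<open>n!\<close> times
  the coefficient of \<open>x ^ n\<close>.\<close>

definition H :: "nat \<Rightarrow> nat \<Rightarrow> nat \<Rightarrow> real" where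
  "H n \<beta> \<gamma> = fact n * fps_nth (fps_exp (real \<gamma>) / (2 - fps_exp (real \<beta>))) n"

end

theory Submission
  imports Defs
begin

text \<open>Let Q_c = e^(cx) / (2 - e^(bx)), the exponential generating function of H_n(b,c). It
  satisfies the differential equation Q_c' = c Q_c + b Q_c Q_b
  (\<open>fps_deriv_exp_quotient\<close>). On exponential generating functions the derivative shifts
  the index and a product is a binomial convolution, so comparing coefficients of x^n / n! gives the
  recurrence.\<close>

lemma fps_exp_quotient_mult:
  fixes b c :: real
  shows "fps_exp c / (2 - fps_exp b) * (2 - fps_exp b) = fps_exp c"
proof -
  \<comment> \<open>The constant term is 2 - 1 = 1, so the denominator is a unit and the division is
    exact.\<close>
  have "(2 - fps_exp b) dvd (1 :: real fps)"
    by (simp add: fps_is_unit_iff)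
  then show ?thesis
    by (meson dvd_div_mult_self dvd_trans one_dvd)
qed

text \<open>Differentiate Q_c D = e^(cx) with D = 2 - e^(bx), then cancel D; this avoids any
  quotient rule.\<close>

lemma fps_deriv_exp_quotient:
  fixes b c :: real
  defines "Q \<equiv> \<lambda>c. fps_exp c / (2 - fps_exp b)"
  shows "fps_deriv (Q c) = fps_const c * Q c + fps_const b * (Q c * Q b)"
proof -
  let ?D = "2 - fps_exp b"
  have "fps_nth ?D 0 \<noteq> 0"
    by simp
  then have nz: "?D \<noteq> 0"
    by (metis fps_zero_nth)
  have Q: "Q c * ?D = fps_exp c" for c
    unfolding Q_def by (rule fps_exp_quotient_mult)
  have D': "fps_deriv ?D = - (fps_const b * fps_exp b)"
    by simp
  have "fps_deriv (Q c) * ?D + Q c * fps_deriv ?D = fps_deriv (Q c * ?D)"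
    by (simp only: fps_deriv_mult add.commute)
  also have "\<dots> = fps_const c * (Q c * ?D)"
    by (simp only: Q fps_exp_deriv)
  \<comment> \<open>The e^(bx) coming from D' is itself Q_b D, so every term acquires the factor D;
    this is where the second factor Q_b arises.\<close>
  finally have "fps_deriv (Q c) * ?D = fps_const c * (Q c * ?D) + Q c * (fps_const b * (Q b * ?D))"
    unfolding D' Q[of b] by (simp add: algebra_simps)
  also have "\<dots> = (fps_const c * Q c + fps_const b * (Q c * Q b)) * ?D"
    by (simp only: algebra_simps)
  finally show ?thesis
    by (rule mult_right_cancel[OF nz, THEN iffD1])
qed

theorem theorem4:
  fixes \<beta> \<gamma> n :: nat
  assumes "(\<beta>, \<gamma>) \<noteq> (0, 0)"
  shows "H (n + 1) \<beta> \<gamma> =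
    real \<gamma> * H n \<beta> \<gamma> + real \<beta> * (\<Sum>i=0..n. real (n choose i) * H i \<beta> \<gamma> * H (n - i) \<beta> \<beta>)"
proof -
  define Q where "Q c = fps_exp (real c) / (2 - fps_exp (real \<beta>))" for c :: nat
  have H: "H k \<beta> c = fact k * fps_nth (Q c) k" for k c
    by (simp add: H_def Q_def)
  have "real (n + 1) * fps_nth (Q \<gamma>) (n + 1) = fps_nth (fps_deriv (Q \<gamma>)) n"
    by (simp only: fps_deriv_nth of_nat_add)
  also have "\<dots> = real \<gamma> * fps_nth (Q \<gamma>) n + real \<beta> * fps_nth (Q \<gamma> * Q \<beta>) n"
    unfolding Q_def fps_deriv_exp_quotient by simp
  finally have "H (n + 1) \<beta> \<gamma> = real \<gamma> * H n \<beta> \<gamma> + real \<beta> * (fact n * fps_nth (Q \<gamma> * Q \<beta>) n)"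
    by (simp add: H algebra_simps flip: distrib_left)
  \<comment> \<open>The Cauchy product becomes a binomial convolution since n! = (n choose i) i!
    (n-i)!.\<close>
  moreover have "fact n * fps_nth (Q \<gamma> * Q \<beta>) n
      = (\<Sum>i=0..n. real (n choose i) * H i \<beta> \<gamma> * H (n - i) \<beta> \<beta>)"
    unfolding fps_mult_nth sum_distrib_left
    by (intro sum.cong refl) (simp add: H binomial_fact)
  ultimately show ?thesis
    by simp
qed

end
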